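(* The number of permutations in $S_n$ with the maximum number of occurrences of the $1$-box pattern (which is $n$) is given by $$\sum_{j=1}^{\lfloor n/2\rfloor}\binom{n-j-1}{j-1}a_j ,$$ where the numbers $a_j$ are given by the recurrence $a_0=1$, $a_1=2$ and $$a_m=(2m-1)a_{m-1}+2(m-2)a_{m-2}\qquad (m\ge 2),$$ or by the exponential generating function $$\sum_{m\ge 0}\frac{a_m t^m}{m!}=1+2\int_0^t \frac{e^{-z}}{(1-2z)^2}\,dz .$$ The initial values for the number of such permutations, starting with the case $n=0$, are $$1, 1, 2, 2, 8, 14, 54, 128, 498, 1426, 5736, 18814, 78886, 287296, 1258018,\ldots.$$
   Context: $S_n$ is the set of permutations $\sigma=\sigma_1\sigma_2\cdots\sigma_n$ of $\{1,\ldots,n\}$ in one-line notation. The entry $\sigma_i$ matches (is an occurrence of) the $1$-box pattern in $\sigma$ if $|\sigma_i-\sigma_{i+1}|=1$ (with $i+1\le n$) or $|\sigma_{i-1}-\sigma_i|=1$ (with $i-1\ge 1$). The number of occurrences of the $1$-box pattern in $\sigma$ is the number of indices $i\in\{1,\dots,n\}$ such that $\sigma_i$ matches the $1$-box pattern.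
   Formalization: The sum formula and "the maximum is n" are stated only for n ≥ 2: for n = 0, 1 the sum is empty (0) although the listed values are 1, 1, and for n = 1 the maximum is 0; the listed values for n = 0, 1 count permutations attaining the actual maximum. *)

theory Defs
  imports
    Complex_Main
    "HOL-Combinatorics.Permutations"
    "HOL-Computational_Algebra.Formal_Power_Series"
begin

definition perms :: "nat \<Rightarrow> (nat \<Rightarrow> nat) set" where
  "perms n = {\<sigma>. \<sigma> permutes {1..n}}"

definition matches_1box :: "nat \<Rightarrow> (nat \<Rightarrow> nat) \<Rightarrow> nat \<Rightarrow> bool" where
  "matches_1box n \<sigma> i \<longleftrightarrow>
     (i + 1 \<le> n \<and> \<bar>int (\<sigma> i) - int (\<sigma> (i + 1))\<bar> = 1) \<or>
     (i - 1 \<ge> 1 \<and> \<bar>int (\<sigma> (i - 1)) - int (\<sigma> i)\<bar> = 1)"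

definition occ_1box :: "nat \<Rightarrow> (nat \<Rightarrow> nat) \<Rightarrow> nat" where
  "occ_1box n \<sigma> = card {i \<in> {1..n}. matches_1box n \<sigma> i}"

definition max_occ_1box :: "nat \<Rightarrow> nat" where
  "max_occ_1box n = Max (occ_1box n ` perms n)"

text \<open>The maximum is taken over the permutations of the given length, so that for
  length \<open>1\<close>, where no entry can match and the maximum is \<open>0\<close>, the count below is \<open>1\<close>.\<close>

definition num_max_1box :: "nat \<Rightarrow> nat" where
  "num_max_1box n = card {\<sigma> \<in> perms n. occ_1box n \<sigma> = max_occ_1box n}"

fun box_num :: "nat \<Rightarrow> nat" where
  "box_num m = (if m = 0 then 1 else if m = 1 then 2
          else (2 * m - 1) * box_num (m - 1) + 2 * (m - 2) * box_num (m - 2))"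

declare box_num.simps [simp del]

end

theory Submission
  imports Defs
begin

text \<open>
  Call \<open>i\<close> a gap of \<open>\<sigma>\<close> if \<open>\<sigma> i\<close> and \<open>\<sigma> (i + 1)\<close> are not neighbouring integers; the gaps cut \<open>\<sigma>\<close>
  into monotone blocks of consecutive values. All entries match iff every block has length at least
  two, that is, iff the gap set is a subset of \<open>{2..n - 2}\<close> without consecutive elements, and there
  are \<open>(n - j - 1) choose (j - 1)\<close> such sets of size \<open>j - 1\<close>. For such a \<open>U\<close> of size \<open>k\<close>, the permutations
  whose gaps lie in \<open>U\<close> arrange \<open>k + 1\<close> blocks in any order and orientation, so their number is
  \<open>2\<^sup>k\<^sup>+\<^sup>1 (k + 1)!\<close>. If \<open>e k\<close> counts those whose gap set is exactly \<open>U\<close>, summing over the subsets of \<open>U\<close>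
  gives \<open>\<Sum>i\<le>k. (k choose i) * e i = 2\<^sup>k\<^sup>+\<^sup>1 (k + 1)!\<close>, so the exponential generating function of
  \<open>e\<close> is \<open>2 exp (-z) / (1 - 2 z)\<^sup>2\<close>, whose differential equation
  \<open>(1 - 2 z) Y' = (3 + 2 z) Y\<close> is the recurrence of \<open>box_num\<close> shifted by one.
\<close>

definition adjacent :: "(nat \<Rightarrow> nat) \<Rightarrow> nat \<Rightarrow> bool" where
  "adjacent \<sigma> i \<longleftrightarrow> \<sigma> (Suc i) = Suc (\<sigma> i) \<or> \<sigma> i = Suc (\<sigma> (Suc i))"

definition gaps :: "nat \<Rightarrow> (nat \<Rightarrow> nat) \<Rightarrow> nat set" where
  "gaps n \<sigma> = {i \<in> {1..<n}. \<not> adjacent \<sigma> i}"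

definition sparse :: "nat set \<Rightarrow> bool" where
  "sparse U \<longleftrightarrow> (\<forall>i\<in>U. Suc i \<notin> U)"

text \<open>Containment instead of equality: this weaker condition has a product formula for its
  count, and \<open>card_gaps_eq\<close> recovers equality from it.\<close>

definition compat :: "nat \<Rightarrow> nat set \<Rightarrow> (nat \<Rightarrow> nat) set" where
  "compat n U = {\<sigma> \<in> perms n. gaps n \<sigma> \<subseteq> U}"

text \<open>Here \<open>c\<close> is the number of old values that stay below the new last one. The
  guard \<open>i \<in> {1..n}\<close> keeps all later points fixed, as \<open>permutes\<close>
  demands.\<close>

definition append_value :: "nat \<Rightarrow> nat \<Rightarrow> (nat \<Rightarrow> nat) \<Rightarrow> nat \<Rightarrow> nat" where
  "append_value n c \<sigma> i =
     (if i = Suc n then Suc c else if i \<in> {1..n} \<and> c < \<sigma> i then Suc (\<sigma> i) else \<sigma> i)"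

text \<open>The values \<open>c\<close> whose insertion at the end separates no pair that \<open>U\<close> requires to stay adjacent.\<close>

definition allowed :: "nat \<Rightarrow> nat set \<Rightarrow> (nat \<Rightarrow> nat) \<Rightarrow> nat set" where
  "allowed n U \<sigma> = {c \<in> {0..n}. (\<forall>i\<in>{1..<n} - U. c \<noteq> min (\<sigma> i) (\<sigma> (Suc i))) \<and>
     (n \<in> U \<or> \<sigma> n = c \<or> \<sigma> n = Suc c)}"

section \<open>Building permutations by appending a last entry\<close>

lemma finite_perms [simp]: "finite (perms n)"
  by (simp add: perms_def finite_permutations)

lemma card_perms: "card (perms n) = fact n"
  unfolding perms_def by (rule card_permutations) auto

lemma perms_range: "\<sigma> \<in> perms n \<Longrightarrow> i \<in> {1..n} \<Longrightarrow> \<sigma> i \<in> {1..n}"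
  unfolding perms_def by (metis mem_Collect_eq permutes_in_image)

lemma perms_outside: "\<sigma> \<in> perms n \<Longrightarrow> i \<notin> {1..n} \<Longrightarrow> \<sigma> i = i"
  unfolding perms_def by (metis mem_Collect_eq permutes_def)

lemma perms_inj: "\<sigma> \<in> perms n \<Longrightarrow> \<sigma> i = \<sigma> j \<longleftrightarrow> i = j"
  unfolding perms_def by (metis mem_Collect_eq permutes_def)

lemma append_value_perms:
  assumes s: "\<sigma> \<in> perms n" and c: "c \<le> n"
  shows "append_value n c \<sigma> \<in> perms (Suc n)"
proof -
  let ?a = "append_value n c \<sigma>"
  have maps: "?a ` {1..Suc n} \<subseteq> {1..Suc n}"
  proof
    fix y assume "y \<in> ?a ` {1..Suc n}"
    then obtain i where i: "i \<in> {1..Suc n}" "y = ?a i" by auto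
    show "y \<in> {1..Suc n}"
      using i c perms_range[OF s, of i] by (cases "i = Suc n") (auto simp: append_value_def)
  qed
  have inj: "inj_on ?a {1..Suc n}"
  proof (rule inj_onI)
    fix i j assume ij: "i \<in> {1..Suc n}" "j \<in> {1..Suc n}" "?a i = ?a j"
    show "i = j"
      using ij c perms_inj[OF s, of i j]
      by (auto simp: append_value_def split: if_splits)
  qed
  have "bij_betw ?a {1..Suc n} {1..Suc n}"
    using maps inj by (simp add: bij_betw_def endo_inj_surj)
  moreover have "?a i = i" if "i \<notin> {1..Suc n}" for i
    using that perms_outside[OF s, of i] by (auto simp: append_value_def)
  ultimately show ?thesis
    unfolding perms_def by (auto intro: bij_imp_permutes)
qed

text \<open>The last entry determines \<open>c\<close>, and undoing the shift determines \<sigma>.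
  Surjectivity follows by counting, since both sides have (n + 1)! elements.\<close>

lemma bij_append_value:
  "bij_betw (\<lambda>(\<sigma>, c). append_value n c \<sigma>) (perms n \<times> {0..n}) (perms (Suc n))"
proof -
  let ?f = "\<lambda>(\<sigma>, c). append_value n c \<sigma>"
  have inj: "inj_on ?f (perms n \<times> {0..n})"
  proof (rule inj_onI, clarify)
    fix \<sigma> c \<tau> d
    assume s: "\<sigma> \<in> perms n" and t: "\<tau> \<in> perms n"
      and eq: "append_value n c \<sigma> = append_value n d \<tau>"
    have cd: "c = d"
      using fun_cong[OF eq, of "Suc n"] by (simp add: append_value_def)
    have "\<sigma> i = \<tau> i" for i
    proof (cases "i \<in> {1..n}")
      case True
      then show ?thesis
        using fun_cong[OF eq, of i] cd by (auto simp: append_value_def split: if_splits)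
    next
      case False
      then show ?thesis using perms_outside s t by metis
    qed
    then show "\<sigma> = \<tau> \<and> c = d" using cd by auto
  qed
  moreover have "?f ` (perms n \<times> {0..n}) = perms (Suc n)"
  proof (rule card_subset_eq)
    show "?f ` (perms n \<times> {0..n}) \<subseteq> perms (Suc n)"
      by (auto intro: append_value_perms)
    show "card (?f ` (perms n \<times> {0..n})) = card (perms (Suc n))"
      by (simp add: card_image[OF inj] card_cartesian_product card_perms)
  qed auto
  ultimately show ?thesis by (simp add: bij_betw_def)
qed

text \<open>Inserting a value just above \<open>c\<close> separates the values \<open>c\<close> and
  \<open>c + 1\<close> and changes no other adjacency among the old entries. Position
  \<open>n\<close> becomes a possible gap only now, hence \<open>U - {n}\<close> for the shorter
  word.\<close>

lemma gaps_append_value: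
  assumes s: "\<sigma> \<in> perms n" and n: "n \<ge> 1" and c: "c \<in> {0..n}"
  shows "gaps (Suc n) (append_value n c \<sigma>) \<subseteq> U \<longleftrightarrow>
         gaps n \<sigma> \<subseteq> U - {n} \<and> c \<in> allowed n U \<sigma>"
proof -
  let ?a = "append_value n c \<sigma>"
  have old: "adjacent ?a i \<longleftrightarrow> adjacent \<sigma> i \<and> c \<noteq> min (\<sigma> i) (\<sigma> (Suc i))" if "i \<in> {1..<n}" for i
    using that perms_inj[OF s, of i "Suc i"] by (auto simp: append_value_def adjacent_def min_def)
  have new: "adjacent ?a n \<longleftrightarrow> \<sigma> n = c \<or> \<sigma> n = Suc c"
    using n by (auto simp: append_value_def adjacent_def)
  have "gaps (Suc n) ?a \<subseteq> U \<longleftrightarrow> (\<forall>i\<in>{1..<n} - U. adjacent ?a i) \<and> (n \<in> U \<or> adjacent ?a n)"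
    using n by (auto simp: gaps_def less_Suc_eq)
  also have "\<dots> \<longleftrightarrow> gaps n \<sigma> \<subseteq> U - {n} \<and> c \<in> allowed n U \<sigma>"
    unfolding new using old c by (auto simp: gaps_def allowed_def)
  finally show ?thesis .
qed

lemma card_compat_Suc:
  assumes n: "n \<ge> 1"
  shows "card (compat (Suc n) U) = (\<Sum>\<sigma>\<in>compat n (U - {n}). card (allowed n U \<sigma>))"
proof -
  let ?f = "\<lambda>(\<sigma>, c). append_value n c \<sigma>"
  let ?S = "Sigma (compat n (U - {n})) (allowed n U)"
  have sub: "?S \<subseteq> perms n \<times> {0..n}"
    by (auto simp: compat_def allowed_def)
  have "compat (Suc n) U = ?f ` {p \<in> perms n \<times> {0..n}. gaps (Suc n) (?f p) \<subseteq> U}"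
    unfolding compat_def bij_betw_imp_surj_on[OF bij_append_value[of n], symmetric]
    by auto
  also have "{p \<in> perms n \<times> {0..n}. gaps (Suc n) (?f p) \<subseteq> U} = ?S"
    using gaps_append_value[OF _ n, of _ _ U] sub by (force simp: compat_def)
  finally have "card (compat (Suc n) U) = card ?S"
    using inj_on_subset[OF bij_betw_imp_inj_on[OF bij_append_value] sub]
    by (simp add: card_image)
  also have "\<dots> = (\<Sum>\<sigma>\<in>compat n (U - {n}). card (allowed n U \<sigma>))"
    by (rule card_SigmaI) (auto simp: compat_def allowed_def)
  finally show ?thesis .
qed

section \<open>Number of ways to append an entry\<close>

text \<open>The new entry opens a block. Each pair kept together by \<open>U\<close> forbids the
  slot between its two values, and different pairs forbid different slots. Of \<open>n + 1\<close>
  slots, \<open>n - card U\<close> are lost; the others lie below, between and above the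
  \<open>card U\<close> old blocks.\<close>

lemma allowed_new_block:
  assumes s: "\<sigma> \<in> compat n (U - {n})" and n: "n \<ge> 1" and U: "U \<subseteq> {2..<Suc n}" "n \<in> U"
  shows "card (allowed n U \<sigma>) = Suc (card U)"
proof -
  have p: "\<sigma> \<in> perms n" and adj: "\<And>i. i \<in> {1..<n} - U \<Longrightarrow> adjacent \<sigma> i"
    using s by (auto simp: compat_def gaps_def)
  let ?m = "\<lambda>i. min (\<sigma> i) (\<sigma> (Suc i))"
  have "allowed n U \<sigma> = {0..n} - ?m ` ({1..<n} - U)"
    using U by (auto simp: allowed_def)
  moreover have "inj_on ?m ({1..<n} - U)"
  proof (rule inj_onI)
    fix i j assume i: "i \<in> {1..<n} - U" and j: "j \<in> {1..<n} - U" and eq: "?m i = ?m j"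
    show "i = j"
      using adj[OF i] adj[OF j] eq perms_inj[OF p, of i j] perms_inj[OF p, of "Suc i" "Suc j"]
        perms_inj[OF p, of i "Suc j"] perms_inj[OF p, of "Suc i" j]
      by (auto simp: adjacent_def min_def split: if_splits)
  qed
  moreover have "?m ` ({1..<n} - U) \<subseteq> {0..n}"
    using perms_range[OF p] by (auto simp: min_le_iff_disj)
  moreover have "card ({1..<n} - U) = n - card U"
  proof -
    have "{1..<n} - U = {1..n} - U" using U by (auto simp: le_less)
    moreover have "U \<subseteq> {1..n}" using U by auto
    ultimately show ?thesis
      by (simp add: card_Diff_subset finite_subset)
  qed
  moreover have "card U \<le> n"
    using card_mono[of "{1..n}" U] U by fastforce
  ultimately show ?thesis
    by (simp add: card_Diff_subset card_image Suc_diff_le)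
qed

text \<open>The last block is position \<open>n\<close> alone, with \<open>insert 0\<close> treating
  the start of the word as a cut. Its second entry may go just above or just below
  \<open>\<sigma> n\<close>, which fixes the orientation.\<close>

lemma allowed_second_entry:
  assumes s: "\<sigma> \<in> compat n (U - {n})" and n: "n \<ge> 1" and U: "n \<notin> U" "n - 1 \<in> insert 0 U"
  shows "card (allowed n U \<sigma>) = 2"
proof -
  have p: "\<sigma> \<in> perms n"
    using s by (auto simp: compat_def)
  have r: "\<sigma> n \<in> {1..n}" using perms_range[OF p, of n] n by auto
  \<comment> \<open>A required pair occupying one of these two slots would contain the value
    \<open>\<sigma> n\<close>, hence the position \<open>n\<close>.\<close>
  have "min (\<sigma> i) (\<sigma> (Suc i)) \<noteq> \<sigma> n \<and> Suc (min (\<sigma> i) (\<sigma> (Suc i))) \<noteq> \<sigma> n"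
    if i: "i \<in> {1..<n} - U" for i
  proof -
    have "adjacent \<sigma> i" using s i by (auto simp: compat_def gaps_def)
    moreover have "i \<noteq> n" "Suc i \<noteq> n" using i U by auto
    ultimately show ?thesis
      using perms_inj[OF p, of i n] perms_inj[OF p, of "Suc i" n]
      by (auto simp: adjacent_def min_def)
  qed
  then have "allowed n U \<sigma> = {\<sigma> n - 1, \<sigma> n}"
    using r U by (fastforce simp: allowed_def)
  then show ?thesis using r by auto
qed

text \<open>The last block already has two entries, so its direction dictates the next
  value.\<close>

lemma allowed_later_entry:
  assumes s: "\<sigma> \<in> compat n (U - {n})" and n: "n \<ge> 1" and U: "n \<notin> U" "n - 1 \<notin> insert 0 U"
  shows "card (allowed n U \<sigma>) = 1"
proof -
  have p: "\<sigma> \<in> perms n" and adj: "\<And>i. i \<in> {1..<n} - U \<Longrightarrow> adjacent \<sigma> i"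
    using s by (auto simp: compat_def gaps_def)
  have r: "\<sigma> n \<in> {1..n}" using perms_range[OF p, of n] n by auto
  obtain m where m: "n = Suc m" "m \<ge> 1" "m \<in> {1..<n} - U"
    using U by (cases n) auto
  \<comment> \<open>A rising block continues above \<open>\<sigma> n\<close>, a falling one below.
    The other candidate is the forbidden slot between \<open>\<sigma> m\<close> and
    \<open>\<sigma> n\<close>.\<close>
  let ?c = "if \<sigma> m < \<sigma> n then \<sigma> n else \<sigma> n - 1"
  have am: "adjacent \<sigma> m" using adj m by auto
  have "c = ?c" if c: "c \<in> allowed n U \<sigma>" for c
  proof -
    have "c \<noteq> min (\<sigma> m) (\<sigma> n)" "\<sigma> n = c \<or> \<sigma> n = Suc c"
      using c m U by (auto simp: allowed_def)
    then show ?thesis using am r m by (auto simp: adjacent_def min_def)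
  qed
  moreover have "?c \<in> allowed n U \<sigma>"
  proof -
    have "?c \<noteq> min (\<sigma> i) (\<sigma> (Suc i))" if i: "i \<in> {1..<n} - U" for i
    proof (cases "i = m")
      case True
      then show ?thesis using am m r by (auto simp: adjacent_def min_def)
    next
      case False
      then have "i \<noteq> n" "Suc i \<noteq> n" using i m by auto
      then show ?thesis using adj[OF i] r perms_inj[OF p, of i n] perms_inj[OF p, of "Suc i" n]
        by (auto simp: adjacent_def min_def)
    qed
    then show ?thesis using r by (auto simp: allowed_def)
  qed
  ultimately have "allowed n U \<sigma> = {?c}" by blast
  then show ?thesis by simp
qed

text \<open>A last block of length one has no orientation, which costs a factor of two.\<close>

lemma card_compat_general:
  assumes "n \<ge> 1" "U \<subseteq> {2..<n}" "sparse U"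
  shows "card (compat n U) =
    2 ^ (if n - 1 \<in> insert 0 U then card U else Suc (card U)) * fact (Suc (card U))"
  using assms
proof (induction n arbitrary: U rule: dec_induct)
  case base
  then have "U = {}" by auto
  moreover have "gaps 1 \<sigma> = {}" for \<sigma> by (auto simp: gaps_def)
  ultimately show ?case using card_perms[of 1] by (simp add: compat_def)
next
  case (step n)
  let ?V = "U - {n}"
  have V: "?V \<subseteq> {2..<n}" "sparse ?V" "finite U"
    using step.prems by (auto simp: sparse_def le_less finite_subset)
  note IH = step.IH[OF V(1,2)]
  note rec = card_compat_Suc[OF step.hyps(1), of U]
  consider "n \<in> U" | "n \<notin> U" "n - 1 \<in> insert 0 U" | "n \<notin> U" "n - 1 \<notin> insert 0 U" by blast
  then show ?case
  proof cases
    case 1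
    \<comment> \<open>Sparsity gives the block that ends at \<open>n\<close> length at least two, so
      the induction hypothesis contributes its full power of two.\<close>
    have "n \<ge> 2" using 1 step.prems by auto
    moreover from this have "n - 1 \<notin> U"
      using 1 step.prems by (auto simp: sparse_def dest: bspec[of _ _ "n - 1"])
    ultimately have nV: "n - 1 \<notin> insert 0 ?V" by auto
    have "card U = Suc (card ?V)" using 1 V by (metis card.remove)
    then have "card (compat (Suc n) U) = 2 ^ card U * fact (card U) * Suc (card U)"
      using rec IH nV allowed_new_block[OF _ step.hyps(1) step.prems(1) 1] by simp
    then show ?thesis using 1 by (simp add: algebra_simps)
  next
    case 2
    then show ?thesis
      using rec IH allowed_second_entry[OF _ step.hyps(1) 2] step.hyps by simp
  next
    case 3
    then show ?thesis
      using rec IH allowed_later_entry[OF _ step.hyps(1) 3] step.hyps by simp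
  qed
qed

lemma card_compat:
  assumes "n \<ge> 2" "U \<subseteq> {2..n - 2}" "sparse U"
  shows "card (compat n U) = 2 ^ Suc (card U) * fact (Suc (card U))"
proof -
  have "U \<subseteq> {2..<n}" "n - 1 \<notin> insert 0 U" using assms(1) subsetD[OF assms(2)] by fastforce+
  then show ?thesis using card_compat_general[of n U] assms by simp
qed

section \<open>The recurrence and its exponential generating function\<close>

lemma box_num_Suc_Suc:
  "box_num (Suc (Suc m)) = (2 * m + 3) * box_num (Suc m) + 2 * m * box_num m"
  by (subst box_num.simps) (simp add: algebra_simps)

lemma box_num_0 [simp]: "box_num 0 = 1" and box_num_1 [simp]: "box_num (Suc 0) = 2"
  by (subst box_num.simps, simp)+

text \<open>The derivative of the exponential generating function of \<open>box_num\<close>.\<close>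

definition box_deriv :: "real fps" where
  "box_deriv = Abs_fps (\<lambda>m. real (box_num (Suc m)) / fact m)"

text \<open>The series 1 / (1 - 2 X)^2, half the derivative of the geometric series 1 / (1 - 2
  X).\<close>

definition geom_deriv :: "real fps" where
  "geom_deriv = Abs_fps (\<lambda>m. real (Suc m) * 2 ^ m)"

lemma one_minus_2X_mult_nth:
  "fps_nth ((1 - 2 * fps_X) * f) 0 = (fps_nth f 0 :: real)"
  "fps_nth ((1 - 2 * fps_X) * f) (Suc m) = fps_nth f (Suc m) - 2 * fps_nth f m"
  by (simp_all add: left_diff_distrib mult.assoc numeral_fps_const)

lemma geom_deriv_inverse: "(1 - 2 * fps_X) ^ 2 * geom_deriv = 1"
proof -
  have "(1 - 2 * fps_X) * Abs_fps (\<lambda>m. 2 ^ m) = (1 :: real fps)"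
  proof (rule fps_ext)
    fix m show "fps_nth ((1 - 2 * fps_X) * Abs_fps (\<lambda>m. 2 ^ m)) m = fps_nth (1 :: real fps) m"
      by (cases m) (simp_all add: one_minus_2X_mult_nth)
  qed
  moreover have "(1 - 2 * fps_X) * geom_deriv = Abs_fps (\<lambda>m. 2 ^ m)"
  proof (rule fps_ext)
    fix m show "fps_nth ((1 - 2 * fps_X) * geom_deriv) m = fps_nth (Abs_fps (\<lambda>m. 2 ^ m)) m"
      by (cases m) (simp_all only: one_minus_2X_mult_nth, simp_all add: geom_deriv_def algebra_simps)
  qed
  ultimately show ?thesis
    by (simp add: power2_eq_square mult.assoc)
qed

lemma geom_deriv_ode: "(1 - 2 * fps_X) * fps_deriv geom_deriv = 4 * geom_deriv"
proof (rule fps_ext)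
  fix m show "fps_nth ((1 - 2 * fps_X) * fps_deriv geom_deriv) m = fps_nth (4 * geom_deriv) m"
    by (cases m) (simp_all only: one_minus_2X_mult_nth, simp_all add: geom_deriv_def numeral_fps_const algebra_simps)
qed

text \<open>By the product rule and \<open>geom_deriv_ode\<close>, the right-hand side satisfies (1
  - 2 X) Y' = 4 Y - (1 - 2 X) Y. Its coefficients therefore obey a second-order recurrence, and they
  are compared with \<open>box_num\<close> by induction.\<close>

lemma box_deriv_eq: "box_deriv = 2 * (fps_exp (-1) * geom_deriv)"
proof -
  define Y :: "real fps" where "Y = 2 * (fps_exp (-1) * geom_deriv)"
  have "(1 - 2 * fps_X) * fps_deriv Y =
      2 * fps_exp (-1) * ((1 - 2 * fps_X) * fps_deriv geom_deriv) - (1 - 2 * fps_X) * Y"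
    unfolding Y_def by (simp add: algebra_simps numeral_fps_const fps_const_neg[symmetric] del: fps_const_neg)
  also have "\<dots> = 3 * Y + 2 * (fps_X * Y)"
    unfolding geom_deriv_ode Y_def by (simp add: algebra_simps)
  finally have ode: "(1 - 2 * fps_X) * fps_deriv Y = 3 * Y + 2 * (fps_X * Y)" .
  have Y0: "fps_nth Y 0 = 2"
    by (simp add: Y_def geom_deriv_def numeral_fps_const)
  have Y1: "fps_nth Y (Suc 0) = 6"
    using arg_cong[OF ode, of "\<lambda>f. fps_nth f 0"] Y0
    by (simp add: one_minus_2X_mult_nth numeral_fps_const)
  have Y2: "real (Suc (Suc m)) * fps_nth Y (Suc (Suc m)) =
      (2 * real m + 5) * fps_nth Y (Suc m) + 2 * fps_nth Y m" for m
    using arg_cong[OF ode, of "\<lambda>f. fps_nth f (Suc m)"]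
    unfolding one_minus_2X_mult_nth by (simp add: numeral_fps_const algebra_simps)
  have "fps_nth Y m = real (box_num (Suc m)) / fact m" for m
  proof (induction m rule: induct_nat_012)
    case 0
    then show ?case using Y0 by simp
  next
    case 1
    then show ?case using Y1 box_num_Suc_Suc[of 0] by simp
  next
    case (ge2 m)
    have "real (Suc (Suc m)) * fps_nth Y (Suc (Suc m)) =
        (2 * real m + 5) * (real (box_num (Suc (Suc m))) / fact (Suc m)) +
        2 * (real (box_num (Suc m)) / fact m)"
      unfolding Y2 ge2.IH ..
    \<comment> \<open>In \<open>box_num_Suc_Suc\<close> at \<open>Suc m\<close> the last term
      carries the factor 2 (m + 1), which turns 1 / (m + 1)! into the 2 / m! above.\<close>
    also have "\<dots> = real (Suc (Suc m)) * (real (box_num (Suc (Suc (Suc m)))) / fact (Suc (Suc m)))"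
      unfolding box_num_Suc_Suc[of "Suc m"] by (simp add: divide_simps) (simp add: algebra_simps)
    finally show ?case by (metis mult_left_cancel of_nat_neq_0)
  qed
  then show ?thesis
    by (intro fps_ext) (simp add: box_deriv_def Y_def)
qed

text \<open>A binomial sum is a product of exponential generating functions with
  \<open>fps_exp 1\<close>. This cancels \<open>fps_exp (-1)\<close> in \<open>box_deriv_eq\<close>
  and leaves 2 / (1 - 2 X)^2.\<close>

lemma sum_binomial_box_num:
  "(\<Sum>k\<le>m. (m choose k) * box_num (Suc k)) = 2 ^ Suc m * fact (Suc m)"
proof -
  have "box_deriv * fps_exp 1 = 2 * ((fps_exp (-1) * fps_exp 1) * geom_deriv)"
    unfolding box_deriv_eq by (simp only: mult_ac)
  also have "\<dots> = 2 * geom_deriv"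
    by (simp flip: fps_exp_add_mult)
  finally have "fps_nth (box_deriv * fps_exp 1) m = 2 * (real (Suc m) * 2 ^ m)"
    by (simp add: geom_deriv_def numeral_fps_const)
  then have *: "fact m * (\<Sum>k\<le>m. real (box_num (Suc k)) / fact k / fact (m - k)) =
      fact m * (2 * (real (Suc m) * 2 ^ m))"
    by (simp add: fps_mult_nth box_deriv_def atLeast0AtMost)
  have "real (\<Sum>k\<le>m. (m choose k) * box_num (Suc k)) =
      fact m * (\<Sum>k\<le>m. real (box_num (Suc k)) / fact k / fact (m - k))"
    unfolding of_nat_sum sum_distrib_left
    by (rule sum.cong) (simp_all add: binomial_fact)
  also have "\<dots> = real (2 ^ Suc m * fact (Suc m))"
    unfolding * by (simp add: algebra_simps)
  finally show ?thesis unfolding of_nat_eq_iff .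
qed

text \<open>Integrating \<open>box_deriv\<close> shifts its coefficients back, and the summand 1
  restores the constant term \<open>box_num 0\<close>.\<close>

lemma box_num_egf:
  "Abs_fps (\<lambda>m. real (box_num m) / fact m) =
     1 + 2 * fps_integral0 (fps_exp (-1) / (1 - 2 * fps_X) ^ 2)"
proof -
  \<comment> \<open>Exhibiting the divisor as a factor of the numerator reduces the division to
    cancelling a nonzero series.\<close>
  have "fps_exp (-1 :: real) / (1 - 2 * fps_X) ^ 2 =
      (fps_exp (-1) * geom_deriv * (1 - 2 * fps_X) ^ 2) / (1 - 2 * fps_X) ^ 2"
    using geom_deriv_inverse by (simp add: mult.assoc mult.commute[of geom_deriv])
  also have "\<dots> = fps_exp (-1) * geom_deriv"
    using geom_deriv_inverse by (intro nonzero_mult_div_cancel_right) auto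
  finally have "2 * fps_integral0 (fps_exp (-1 :: real) / (1 - 2 * fps_X) ^ 2) =
      fps_integral0 box_deriv"
    unfolding box_deriv_eq by (simp add: numeral_fps_const fps_integral0_fps_const_mult_left)
  moreover have "Abs_fps (\<lambda>m. real (box_num m) / fact m) = 1 + fps_integral0 box_deriv"
  proof (rule fps_ext)
    fix m show "fps_nth (Abs_fps (\<lambda>m. real (box_num m) / fact m)) m =
        fps_nth (1 + fps_integral0 box_deriv) m"
      by (cases m) (simp_all add: box_deriv_def fps_integral_def field_simps)
  qed
  ultimately show ?thesis by simp
qed

section \<open>Permutations with a prescribed gap set\<close>

lemma sum_Pow_card:
  fixes f :: "nat \<Rightarrow> nat"
  assumes "finite U"
  shows "(\<Sum>V\<in>Pow U. f (card V)) = (\<Sum>k\<le>card U. (card U choose k) * f k)"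
proof -
  have "(\<Sum>V\<in>Pow U. f (card V)) = (\<Sum>k\<le>card U. \<Sum>V | V \<in> Pow U \<and> card V = k. f (card V))"
    by (rule sum.group[symmetric]) (use assms in \<open>auto intro: card_mono\<close>)
  also have "\<dots> = (\<Sum>k\<le>card U. (card U choose k) * f k)"
    by (rule sum.cong) (simp_all add: n_subsets[OF assms])
  finally show ?thesis .
qed

lemma sparse_subset: "sparse U \<Longrightarrow> V \<subseteq> U \<Longrightarrow> sparse V"
  by (auto simp: sparse_def)

text \<open>Both sides have the same sum over all subsets of \<open>U\<close>, by
  \<open>card_compat\<close> and \<open>sum_binomial_box_num\<close>. Subsets of sparse sets are
  sparse, so induction cancels the terms of the proper subsets.\<close>

lemma card_gaps_eq:
  assumes "n \<ge> 2" "U \<subseteq> {2..n - 2}" "sparse U"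
  shows "card {\<sigma> \<in> perms n. gaps n \<sigma> = U} = box_num (Suc (card U))"
proof -
  have "finite U" using assms(2) finite_subset by blast
  then show ?thesis using assms(2,3)
  proof (induction U rule: finite_psubset_induct)
    case (psubset U)
    let ?e = "\<lambda>V. card {\<sigma> \<in> perms n. gaps n \<sigma> = V}"
    let ?b = "\<lambda>V. box_num (Suc (card V))"
    have IH: "?e V = ?b V" if "V \<in> Pow U - {U}" for V
      using that psubset sparse_subset[of U V] by (intro psubset.IH) auto
    have "?e U + (\<Sum>V\<in>Pow U - {U}. ?e V) = (\<Sum>V\<in>Pow U. ?e V)"
      by (rule sum.remove[symmetric]) (use psubset in auto)
    also have "\<dots> = (\<Sum>V\<in>Pow U. \<Sum>\<sigma> | \<sigma> \<in> compat n U \<and> gaps n \<sigma> = V. 1)"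
      by (intro sum.cong) (auto simp: compat_def intro!: arg_cong[of _ _ card])
    also have "\<dots> = card (compat n U)"
      by (subst sum.group) (use psubset in \<open>auto simp: compat_def\<close>)
    also have "\<dots> = (\<Sum>V\<in>Pow U. ?b V)"
      using card_compat[OF assms(1) psubset.prems] sum_binomial_box_num[of "card U"]
        sum_Pow_card[OF psubset.hyps(1), of "\<lambda>k. box_num (Suc k)"] by simp
    also have "\<dots> = ?b U + (\<Sum>V\<in>Pow U - {U}. ?b V)"
      by (rule sum.remove) (use psubset in auto)
    also have "(\<Sum>V\<in>Pow U - {U}. ?b V) = (\<Sum>V\<in>Pow U - {U}. ?e V)"
      by (rule sum.cong) (simp_all add: IH)
    finally show ?case by simp
  qed
qed

section \<open>Counting sets without consecutive elements\<close>

definition sparse_sets :: "nat \<Rightarrow> nat set set" where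
  "sparse_sets m = {U. U \<subseteq> {2..m} \<and> sparse U}"

lemma finite_sparse_sets [simp]: "finite (sparse_sets m)"
  by (rule finite_subset[of _ "Pow {2..m}"]) (auto simp: sparse_sets_def)

lemma sparse_sets_finite: "U \<in> sparse_sets m \<Longrightarrow> finite U"
  by (auto simp: sparse_sets_def intro: finite_subset)

text \<open>Split by whether the largest point \<open>m + 2\<close> belongs to the set. If it does,
  \<open>m + 1\<close> does not, and removing it leaves a sparse subset of
  \<open>{2..m}\<close>.\<close>

lemma card_sparse_sets: "card {U \<in> sparse_sets m. card U = k} = (m - k choose k)"
proof (induction m arbitrary: k rule: induct_nat_012)
  case 0
  have "{U \<in> sparse_sets 0. card U = k} = (if k = 0 then {{}} else {})"
    by (auto simp: sparse_sets_def sparse_def)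
  then show ?case by simp
next
  case 1
  have "{U \<in> sparse_sets (Suc 0). card U = k} = (if k = 0 then {{}} else {})"
    by (auto simp: sparse_sets_def sparse_def)
  then show ?case by (cases k) auto
next
  case (ge2 m)
  show ?case
  proof (cases k)
    case 0
    have "{U \<in> sparse_sets (Suc (Suc m)). card U = k} = {{}}"
      using 0 sparse_sets_finite[of _ "Suc (Suc m)"] by (auto simp: sparse_sets_def sparse_def)
    then show ?thesis using 0 by simp
  next
    case (Suc l)
    let ?x = "Suc (Suc m)"
    let ?A = "{U \<in> sparse_sets (Suc m). card U = k}"
    let ?B = "{U \<in> sparse_sets m. card U = l}"
    have x: "?x \<notin> U" if "U \<in> ?B" for U
      using that by (auto simp: sparse_sets_def)
    have "{U \<in> sparse_sets ?x. card U = k} = ?A \<union> insert ?x ` ?B"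
    proof (intro equalityI subsetI)
      fix U assume U: "U \<in> {U \<in> sparse_sets ?x. card U = k}"
      show "U \<in> ?A \<union> insert ?x ` ?B"
      proof (cases "?x \<in> U")
        case True
        have "Suc m \<notin> U" using True U by (auto simp: sparse_sets_def sparse_def)
        then have "U - {?x} \<subseteq> {2..m}"
          using U by (fastforce simp: sparse_sets_def le_Suc_eq)
        moreover have "sparse (U - {?x})"
          using U sparse_subset[of U "U - {?x}"] by (auto simp: sparse_sets_def)
        moreover have "card (U - {?x}) = l"
          using U True Suc sparse_sets_finite by simp
        ultimately have "U - {?x} \<in> ?B" by (simp add: sparse_sets_def)
        moreover have "U = insert ?x (U - {?x})" using True by auto
        ultimately show ?thesis by blast
      next
        case False
        then show ?thesis using U by (fastforce simp: sparse_sets_def le_Suc_eq)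
      qed
    next
      fix U assume "U \<in> ?A \<union> insert ?x ` ?B"
      then show "U \<in> {U \<in> sparse_sets ?x. card U = k}"
      proof
        assume "U \<in> ?A"
        then show ?thesis by (auto simp: sparse_sets_def)
      next
        assume "U \<in> insert ?x ` ?B"
        then obtain V where V: "V \<in> ?B" "U = insert ?x V" by auto
        then have "sparse U" "U \<subseteq> {2..?x}" by (auto simp: sparse_sets_def sparse_def)
        moreover have "card U = k"
          using V x[OF V(1)] Suc sparse_sets_finite[of V m] by simp
        ultimately show ?thesis by (simp add: sparse_sets_def)
      qed
    qed
    moreover have "?A \<inter> insert ?x ` ?B = {}"
      by (auto simp: sparse_sets_def)
    moreover have "card (insert ?x ` ?B) = card ?B"
      by (rule card_image, rule inj_onI) (metis x insert_ident)
    ultimately have "card {U \<in> sparse_sets ?x. card U = k} = card ?A + card ?B"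
      by (simp add: card_Un_disjoint)
    also have "\<dots> = (m - l choose Suc l) + (m - l choose l)"
      using ge2.IH Suc by simp
    \<comment> \<open>For \<open>l \<le> m\<close> this is Pascal's rule. Otherwise truncated
      subtraction makes every upper index 0 while the lower ones are positive.\<close>
    also have "\<dots> = (?x - k choose k)"
      using Suc by (cases "l \<le> m") (simp_all add: Suc_diff_le binomial_eq_0)
    finally show ?thesis .
  qed
qed

section \<open>From the 1-box pattern to gap sets\<close>

lemma matches_1box_iff:
  assumes "i \<in> {1..n}"
  shows "matches_1box n \<sigma> i \<longleftrightarrow> (i < n \<and> i \<notin> gaps n \<sigma>) \<or> (i \<ge> 2 \<and> i - 1 \<notin> gaps n \<sigma>)"
proof -
  have adj: "\<bar>int (\<sigma> j) - int (\<sigma> (Suc j))\<bar> = 1 \<longleftrightarrow> adjacent \<sigma> j" for j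
    by (auto simp: adjacent_def)
  have "i \<ge> 2 \<Longrightarrow> Suc (i - 1) = i" by simp
  then show ?thesis
    using assms adj[of i] adj[of "i - 1"]
    by (cases "i \<ge> 2") (auto simp: matches_1box_def gaps_def)
qed

text \<open>The first entry fails to match iff 1 is a gap, the last iff \<open>n - 1\<close> is, and
  an inner entry \<open>i\<close> iff both \<open>i - 1\<close> and \<open>i\<close> are.\<close>

lemma occ_1box_eq_iff:
  assumes "n \<ge> 2"
  shows "occ_1box n \<sigma> = n \<longleftrightarrow> gaps n \<sigma> \<in> sparse_sets (n - 2)"
proof -
  let ?G = "gaps n \<sigma>"
  have G: "?G \<subseteq> {1..<n}" by (auto simp: gaps_def)
  have "{i \<in> {1..n}. matches_1box n \<sigma> i} \<subseteq> {1..n}" by blast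
  then have "occ_1box n \<sigma> = n \<longleftrightarrow> {i \<in> {1..n}. matches_1box n \<sigma> i} = {1..n}"
    unfolding occ_1box_def by (metis card_atLeastAtMost card_subset_eq diff_Suc_1 finite_atLeastAtMost)
  also have "\<dots> \<longleftrightarrow> (\<forall>i\<in>{1..n}. (i < n \<and> i \<notin> ?G) \<or> (i \<ge> 2 \<and> i - 1 \<notin> ?G))"
    using matches_1box_iff[of _ n \<sigma>] by auto
  also have "\<dots> \<longleftrightarrow> ?G \<subseteq> {2..n - 2} \<and> sparse ?G"
  proof (intro iffI conjI ballI subsetI)
    fix i assume *: "\<forall>i\<in>{1..n}. (i < n \<and> i \<notin> ?G) \<or> (i \<ge> 2 \<and> i - 1 \<notin> ?G)" and i: "i \<in> ?G"
    have "i \<noteq> 1" "i \<noteq> n - 1" using *[rule_format, of 1] *[rule_format, of n] i assms by auto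
    then show "i \<in> {2..n - 2}" using i G by (auto dest!: subsetD)
  next
    assume *: "\<forall>i\<in>{1..n}. (i < n \<and> i \<notin> ?G) \<or> (i \<ge> 2 \<and> i - 1 \<notin> ?G)"
    show "sparse ?G" unfolding sparse_def
    proof (intro ballI notI)
      fix i assume i: "i \<in> ?G" "Suc i \<in> ?G"
      show False using *[rule_format, of "Suc i"] i G by auto
    qed
  next
    fix i assume *: "?G \<subseteq> {2..n - 2} \<and> sparse ?G" and i: "i \<in> {1..n}"
    have 1: "1 \<notin> ?G" "n - 1 \<notin> ?G" using * assms by force+
    have 2: "i - 1 \<in> ?G \<Longrightarrow> i \<notin> ?G" using * i by (auto simp: sparse_def dest: bspec[of _ _ "i - 1"])
    show "(i < n \<and> i \<notin> ?G) \<or> (i \<ge> 2 \<and> i - 1 \<notin> ?G)"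
      using 1 2 i assms by (cases "i = 1"; cases "i = n") auto
  qed
  finally show ?thesis by (simp add: sparse_sets_def)
qed

text \<open>The identity has no gaps and so attains the trivial bound \<open>n\<close>.\<close>

lemma max_occ_1box:
  assumes "n \<ge> 2"
  shows "max_occ_1box n = n"
  unfolding max_occ_1box_def
proof (rule Max_eqI)
  show "finite (occ_1box n ` perms n)" by simp
next
  have "occ_1box n \<sigma> \<le> card {1..n}" for \<sigma>
    unfolding occ_1box_def by (rule card_mono) auto
  then show "y \<le> n" if "y \<in> occ_1box n ` perms n" for y
    using that by auto
next
  have "gaps n id = {}" by (auto simp: gaps_def adjacent_def)
  then have "occ_1box n id = n"
    using occ_1box_eq_iff[OF assms] by (simp add: sparse_sets_def sparse_def)
  moreover have "id \<in> perms n" by (simp add: perms_def permutes_id)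
  ultimately show "n \<in> occ_1box n ` perms n" by (metis image_eqI)
qed

text \<open>Group the permutations by gap set and the gap sets by size \<open>k\<close>; the index
  \<open>j = k + 1\<close> is the number of blocks.\<close>

lemma num_max_1box:
  assumes n: "n \<ge> 2"
  shows "num_max_1box n = (\<Sum>j = 1..n div 2. ((n - j - 1) choose (j - 1)) * box_num j)"
proof -
  let ?S = "sparse_sets (n - 2)"
  have "num_max_1box n = (\<Sum>\<sigma> | \<sigma> \<in> perms n \<and> gaps n \<sigma> \<in> ?S. 1)"
    unfolding num_max_1box_def max_occ_1box[OF n] occ_1box_eq_iff[OF n] by simp
  also have "\<dots> = (\<Sum>U\<in>?S. \<Sum>\<sigma> | \<sigma> \<in> {\<sigma> \<in> perms n. gaps n \<sigma> \<in> ?S} \<and> gaps n \<sigma> = U. 1)"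
    by (rule sum.group[symmetric]) auto
  also have "\<dots> = (\<Sum>U\<in>?S. card {\<sigma> \<in> perms n. gaps n \<sigma> = U})"
    by (intro sum.cong) (auto intro!: arg_cong[of _ _ card])
  also have "\<dots> = (\<Sum>U\<in>?S. box_num (Suc (card U)))"
    by (rule sum.cong) (auto simp: sparse_sets_def intro: card_gaps_eq[OF n])
  also have "\<dots> = (\<Sum>k<n div 2. \<Sum>U | U \<in> ?S \<and> card U = k. box_num (Suc (card U)))"
  proof (rule sum.group[symmetric])
    show "card ` ?S \<subseteq> {..<n div 2}"
    proof clarify
      fix U assume "U \<in> ?S"
      \<comment> \<open>The set \<open>U\<close> itself shows that its size class is nonempty, so
        the binomial coefficient counting that class is nonzero, which bounds
        \<open>card U\<close>.\<close>
      then have "card {V \<in> ?S. card V = card U} \<noteq> 0" by auto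
      then have "card U \<le> n - 2 - card U"
        unfolding card_sparse_sets by (metis binomial_eq_0 not_le)
      then show "card U < n div 2" using n by linarith
    qed
  qed auto
  also have "\<dots> = (\<Sum>k<n div 2. (n - 2 - k choose k) * box_num (Suc k))"
    by (rule sum.cong) (simp_all add: card_sparse_sets)
  also have "\<dots> = (\<Sum>j = 1..n div 2. ((n - j - 1) choose (j - 1)) * box_num j)"
    by (rule sum.reindex_bij_witness[of _ "\<lambda>j. j - 1" Suc]) (auto simp: algebra_simps)
  finally show ?thesis .
qed

text \<open>Covers the lengths 0 and 1: a sole permutation attains the maximum, whatever its
  value.\<close>

lemma num_max_1box_singleton:
  assumes "perms n = {id}"
  shows "num_max_1box n = 1"
proof -
  have "{\<sigma> \<in> perms n. occ_1box n \<sigma> = max_occ_1box n} = {id}"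
    using assms by (auto simp: max_occ_1box_def)
  then show ?thesis by (simp add: num_max_1box_def)
qed

lemma num_max_1box_values:
  "map num_max_1box [0..<15] =
     [1, 1, 2, 2, 8, 14, 54, 128, 498, 1426, 5736, 18814, 78886, 287296, 1258018]"
proof -
  have 01: "num_max_1box 0 = 1" "num_max_1box 1 = 1"
    by (rule num_max_1box_singleton; simp add: perms_def)+
  \<comment> \<open>The largest length is 14, so the sums stop at \<open>j = 7\<close>.\<close>
  have b: "box_num 1 = 2" "box_num 2 = 6" "box_num 3 = 34" "box_num 4 = 262"
    "box_num 5 = 2562" "box_num 6 = 30278" "box_num 7 = 419234"
    by (simp_all add: box_num.simps)
  have "[0..<15] = [0, 1, 2, 3, 4, 5, 6, 7, 8, 9, 10, 11, 12, 13, 14]"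
    by (simp add: upt_rec)
  moreover have "{1..2} = {1, 2::nat}" "{1..3} = {1, 2, 3::nat}" "{1..4} = {1, 2, 3, 4::nat}"
    "{1..5} = {1, 2, 3, 4, 5::nat}" "{1..6} = {1, 2, 3, 4, 5, 6::nat}"
    "{1..7} = {1, 2, 3, 4, 5, 6, 7::nat}"
    by auto
  ultimately show ?thesis
    using b by (simp only: list.map 01)
      (simp add: num_max_1box fact_numeral binomial_fact')
qed

theorem theorem2:
  shows "(\<forall>n\<ge>2. max_occ_1box n = n \<and>
            num_max_1box n = (\<Sum>j = 1..n div 2. ((n - j - 1) choose (j - 1)) * box_num j)) \<and>
         Abs_fps (\<lambda>m. real (box_num m) / fact m) =
            1 + 2 * fps_integral0 (fps_exp (-1) / (1 - 2 * fps_X) ^ 2) \<and>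
         map num_max_1box [0..<15] =
            [1, 1, 2, 2, 8, 14, 54, 128, 498, 1426, 5736, 18814, 78886, 287296, 1258018]"
  using max_occ_1box num_max_1box box_num_egf num_max_1box_values by blast

end
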